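(* For $\alpha\in(0,1]$ let $S_\alpha=\{S_\alpha(t),t\ge0\}$ be the subordinator with $\mathbb{E}e^{-\eta S_\alpha(t)}=e^{-t\alpha\gamma(\alpha;\eta)}$, $\eta,t\ge 0$. 1) Let $\alpha\in(0,1)$. Then, for any $t\ge 0$ and for $x\to+\infty$, $$P(S_\alpha(t)>x)\simeq \frac{t\,x^{-\alpha}}{\Gamma(1-\alpha)}.$$ 2) Let $p\in(0,1]$. Then the fractional moment of order $p$ of the process $S_\alpha$ exists, finite, for $p\le\alpha$, and it asymptotically behaves as follows: $$\mathbb{E}S_\alpha^{p}(t)\simeq\frac{\Gamma\left(1-\frac{p}{\alpha}\right)}{\Gamma(1-p)}\,t^{p/\alpha},\qquad t\to+\infty.$$
   Context: $\gamma(\alpha;x)=\int_0^x e^{-w}w^{\alpha-1}\,dw$ is the lower-incomplete gamma function. A subordinator is a Lévy process with non-decreasing paths; the function $\alpha\gamma(\alpha;\cdot)$ is a Bernstein function, so $S_\alpha$ exists. The fractional moment of order $p$ is $\mathbb{E}S_\alpha^p(t)=\mathbb{E}[(S_\alpha(t))^p]$. The symbol $\simeq$ denotes asymptotic equivalence (the ratio of the two sides tends to $1$; for $t=0$ in part 1 both sides are zero).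
   Formalization: In part 2 the case p = α < 1 is excluded, since by part 1 the moment of order α is infinite for t > 0 (and Γ(0) is undefined); for p = α = 1 the undefined coefficient Γ(0)/Γ(0) is read as 1, as E S_1(t) = t. *)

theory Defs
  imports "HOL-Probability.Probability" "HOL-Library.Landau_Symbols"
begin

definition lower_incomplete_gamma :: "real \<Rightarrow> real \<Rightarrow> real" where
  "lower_incomplete_gamma \<alpha> x = (LBINT w:{0..x}. exp (- w) * w powr (\<alpha> - 1))"

text \<open>
  Real-valued Levy processes. The time parameter is a nonnegative real, so all conditions are
  guarded; the values of \<open>X\<close> at negative times play no role. As usual for Levy processes,
  the initial value and the path regularity are required up to a null set.
\<close>

locale levy_process = prob_space M for M :: "'a measure" +
  fixes X :: "real \<Rightarrow> 'a \<Rightarrow> real"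
  assumes random_variable_X: "t \<ge> 0 \<Longrightarrow> random_variable borel (X t)"
    and start_zero: "AE \<omega> in M. X 0 \<omega> = 0"
    and independent_increments:
      "\<And>(n::nat) \<tau>. 0 \<le> \<tau> 0 \<Longrightarrow> (\<And>i. i < n \<Longrightarrow> \<tau> i \<le> \<tau> (Suc i)) \<Longrightarrow>
         indep_vars (\<lambda>_. borel) (\<lambda>i \<omega>. X (\<tau> (Suc i)) \<omega> - X (\<tau> i) \<omega>) {..<n}"
    and stationary_increments:
      "s \<ge> 0 \<Longrightarrow> t \<ge> 0 \<Longrightarrow>
         distr M borel (\<lambda>\<omega>. X (s + t) \<omega> - X s \<omega>) = distr M borel (\<lambda>\<omega>. X t \<omega> - X 0 \<omega>)"
    and stochastically_continuous:
      "t \<ge> 0 \<Longrightarrow> \<epsilon> > 0 \<Longrightarrow>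
         ((\<lambda>s. prob {\<omega> \<in> space M. \<bar>X s \<omega> - X t \<omega>\<bar> > \<epsilon>}) \<longlongrightarrow> 0) (at t within {0..})"
    and cadlag_paths:
      "AE \<omega> in M. (\<forall>t\<ge>0. ((\<lambda>s. X s \<omega>) \<longlongrightarrow> X t \<omega>) (at_right t)) \<and>
                  (\<forall>t>0. \<exists>l. ((\<lambda>s. X s \<omega>) \<longlongrightarrow> l) (at_left t))"

locale subordinator = levy_process +
  assumes nondecreasing_paths: "AE \<omega> in M. mono_on {0..} (\<lambda>t. X t \<omega>)"

end

theory Submission
  imports Defs "HOL-Real_Asymp.Real_Asymp"
begin

text \<open>
  Only the Laplace transform of the single variable \<open>S t\<close>, which is almost surely nonnegative,
  matters. Since \<open>exp (- \<eta>) * \<eta> powr \<alpha> \<le> \<phi> \<eta> \<le> \<eta> powr \<alpha>\<close> for \<open>\<phi> \<eta> = \<alpha> * lower_incomplete_gamma \<alpha> \<eta>\<close>,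
  we have \<open>1 - exp (- t * \<phi> \<eta>) \<sim> t * \<eta> powr \<alpha>\<close> as \<open>\<eta> \<rightarrow> 0\<close>, and the left-hand side divided by \<open>\<eta>\<close>
  is the Laplace transform of the decreasing function \<open>x \<mapsto> P (S t > x)\<close>; Karamata's Tauberian
  theorem then gives the tail.

  For the moments, \<open>s powr p\<close> is \<open>p / Gamma (1 - p)\<close> times the integral of
  \<open>(1 - exp (- u * s)) * u powr (- p - 1)\<close> over \<open>u > 0\<close>. Taking expectations and substituting
  \<open>u = t powr (- 1 / \<alpha>) * v\<close> extracts the factor \<open>t powr (p / \<alpha>)\<close>, and the remaining integrand converges,
  dominated by its limit \<open>(1 - exp (- v powr \<alpha>)) * v powr (- p - 1)\<close>. For \<open>p = \<alpha> = 1\<close> the mean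
  is the derivative of the Laplace transform at \<open>0\<close>.
\<close>

subsection \<open>Laplace transforms and Gamma integrals\<close>

text \<open>Euler's integral after the substitution \<open>y \<mapsto> l * y\<close>. It supplies
  the moments of the limit function in Karamata's theorem and the constants in the moment
  formulas.\<close>

lemma has_bochner_integral_Gamma:
  fixes b l :: real
  assumes "0 < b" "0 < l"
  shows "has_bochner_integral lborel
    (\<lambda>y. indicator {0<..} y * (exp (- (l * y)) * y powr (b - 1))) (Gamma b / l powr b)"
proof -
  let ?f = "\<lambda>y::real. indicator {0<..} y * (exp (- y) * y powr (b - 1))"
  have "(\<integral>\<^sup>+y. ennreal (?f y) \<partial>lborel) = ennreal (Gamma b)"
    unfolding Gamma_conv_nn_integral_real[OF assms(1)]
    by (intro nn_integral_cong) (auto simp: indicator_def exp_minus field_simps)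
  then have "has_bochner_integral lborel ?f (Gamma b)"
    using assms by (intro has_bochner_integral_nn_integral) (auto simp: less_imp_le)
  then have "has_bochner_integral lborel (\<lambda>y. ?f (0 + l * y)) (Gamma b /\<^sub>R \<bar>l\<bar>)"
    using assms by (subst (asm) lborel_has_bochner_integral_real_affine_iff[of l _ _ 0]) auto
  \<comment> \<open>The factor \<open>l powr (1 - b)\<close> cancels the power of \<open>l\<close>
    contained in \<open>(l * y) powr (b - 1)\<close>; with the Jacobian \<open>1 / l\<close> it
    leaves \<open>l powr (- b)\<close>.\<close>
  then have "has_bochner_integral lborel (\<lambda>y. l powr (1 - b) * ?f (0 + l * y))
      (l powr (1 - b) * (Gamma b /\<^sub>R \<bar>l\<bar>))"
    by (rule has_bochner_integral_mult_right)
  also have "(\<lambda>y. l powr (1 - b) * ?f (0 + l * y)) =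
      (\<lambda>y. indicator {0<..} y * (exp (- (l * y)) * y powr (b - 1)))"
    using assms by (auto simp: fun_eq_iff indicator_def powr_mult zero_less_mult_iff
        powr_diff field_simps)
  also have "l powr (1 - b) * (Gamma b /\<^sub>R \<bar>l\<bar>) = Gamma b / l powr b"
    using assms by (simp add: powr_diff field_simps)
  finally show ?thesis .
qed

lemma nn_integral_powr_tail:
  fixes d p :: real
  assumes "0 < d" "0 < p"
  shows "(\<integral>\<^sup>+u. ennreal (u powr (- p - 1)) * indicator {d..} u \<partial>lborel) = ennreal (d powr (- p) / p)"
proof -
  have "(\<integral>\<^sup>+u. ennreal (u powr (- p - 1)) * indicator {d..} u \<partial>lborel)
      = ennreal (0 - (- (d powr (- p) / p)))"
  proof (rule nn_integral_FTC_atLeast)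
    show "((\<lambda>u. - (u powr (- p) / p)) has_real_derivative u powr (- p - 1)) (at u)" if "d \<le> u" for u
      using that assms by (auto intro!: derivative_eq_intros)
    show "((\<lambda>u. - (u powr - p / p)) \<longlongrightarrow> 0) at_top"
      using assms by real_asymp
  qed auto
  then show ?thesis by simp
qed

lemma nn_integral_exp_initial:
  fixes v :: real
  assumes "0 \<le> v"
  shows "(\<integral>\<^sup>+w. ennreal (exp (- w)) * indicator {0..v} w \<partial>lborel) = ennreal (1 - exp (- v))"
proof -
  have "(\<integral>\<^sup>+w. ennreal (exp (- w)) * indicator {0..v} w \<partial>lborel) = ennreal (- exp (- v) - (- exp (- 0)))"
    using assms
    by (intro nn_integral_FTC_Icc) (auto intro!: derivative_eq_intros simp flip: has_real_derivative_iff_has_vector_derivative)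
  then show ?thesis by simp
qed

text \<open>Writing \<open>1 - exp (- v)\<close> as the integral of \<open>exp (- w)\<close> over \<open>[0, v]\<close> and exchanging the
  order of integration leaves a Gamma integral.\<close>

lemma has_bochner_integral_one_minus_exp_powr:
  fixes a c p :: real
  assumes "0 < p" "p < a" "0 \<le> c"
  shows "has_bochner_integral lborel
    (\<lambda>u. indicator {0<..} u * ((1 - exp (- (c * u powr a))) * u powr (- p - 1)))
    (c powr (p / a) * (Gamma (1 - p / a) / p))"
proof (cases "c = 0")
  case True
  then show ?thesis using assms by (simp add: has_bochner_integral_zero)
next
  case False
  with assms have c: "0 < c" and a: "0 < a" by auto
  let ?f = "\<lambda>u. indicator {0<..} u * ((1 - exp (- (c * u powr a))) * u powr (- p - 1))"
  have "(\<integral>\<^sup>+u. ennreal (?f u) \<partial>lborel)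
      = (\<integral>\<^sup>+u. \<integral>\<^sup>+w. (if 0 < u \<and> 0 < w \<and> w \<le> c * u powr a
            then ennreal (u powr (- p - 1)) * ennreal (exp (- w)) else 0) \<partial>lborel \<partial>lborel)"
  proof (intro nn_integral_cong)
    fix u :: real
    show "ennreal (?f u) = (\<integral>\<^sup>+w. (if 0 < u \<and> 0 < w \<and> w \<le> c * u powr a
            then ennreal (u powr (- p - 1)) * ennreal (exp (- w)) else 0) \<partial>lborel)"
    proof (cases "0 < u")
      case True
      have "(\<integral>\<^sup>+w. (if 0 < u \<and> 0 < w \<and> w \<le> c * u powr a
            then ennreal (u powr (- p - 1)) * ennreal (exp (- w)) else 0) \<partial>lborel)
          = (\<integral>\<^sup>+w. ennreal (u powr (- p - 1)) * (ennreal (exp (- w)) * indicator {0..c * u powr a} w) \<partial>lborel)"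
        \<comment> \<open>The two integrands differ only at \<open>w = 0\<close>, a null
          set.\<close>
        using True
        by (intro nn_integral_cong_AE, use AE_lborel_singleton[of 0] in eventually_elim)
           (auto simp: indicator_def)
      also have "\<dots> = ennreal (u powr (- p - 1)) * ennreal (1 - exp (- (c * u powr a)))"
        using c by (subst nn_integral_cmult) (auto simp: nn_integral_exp_initial)
      also have "\<dots> = ennreal (?f u)"
        using True by (simp add: ennreal_mult'' c less_imp_le mult.commute)
      finally show ?thesis ..
    qed auto
  qed
  also have "\<dots> = (\<integral>\<^sup>+w. \<integral>\<^sup>+u. (if 0 < u \<and> 0 < w \<and> w \<le> c * u powr a
            then ennreal (u powr (- p - 1)) * ennreal (exp (- w)) else 0) \<partial>lborel \<partial>lborel)"
    by (rule lborel_pair.Fubini'[symmetric]) simp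
  also have "\<dots> = (\<integral>\<^sup>+w. ennreal (c powr (p / a) / p) *
      ennreal (indicator {0<..} w * (exp (- (1 * w)) * w powr ((1 - p / a) - 1))) \<partial>lborel)"
  proof (intro nn_integral_cong)
    fix w :: real
    show "(\<integral>\<^sup>+u. (if 0 < u \<and> 0 < w \<and> w \<le> c * u powr a
            then ennreal (u powr (- p - 1)) * ennreal (exp (- w)) else 0) \<partial>lborel)
        = ennreal (c powr (p / a) / p) *
          ennreal (indicator {0<..} w * (exp (- (1 * w)) * w powr ((1 - p / a) - 1)))"
    proof (cases "0 < w")
      case w: True
      \<comment> \<open>For fixed \<open>w\<close>, \<open>d\<close> is the positive root of
        \<open>c * u powr a = w\<close>, so the region of integration in \<open>u\<close> is the
        half-line from \<open>d\<close> on.\<close>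
      define d where "d = (w / c) powr (1 / a)"
      have d: "0 < d" using w c by (simp add: d_def)
      have d_powr: "d powr a = w / c"
        using w c a by (simp add: d_def powr_powr)
      have d_le: "0 < u \<and> w \<le> c * u powr a \<longleftrightarrow> d \<le> u" for u
      proof (cases "0 < u")
        case True
        have "w \<le> c * u powr a \<longleftrightarrow> d powr a \<le> u powr a"
          using c by (simp add: d_powr field_simps)
        also have "\<dots> \<longleftrightarrow> d \<le> u"
          using d True a by (auto intro: powr_mono2 ccontr dest: powr_less_mono2[of a u d])
        finally show ?thesis using True by simp
      qed (use d in auto)
      have "(\<integral>\<^sup>+u. (if 0 < u \<and> 0 < w \<and> w \<le> c * u powr a
            then ennreal (u powr (- p - 1)) * ennreal (exp (- w)) else 0) \<partial>lborel)
        = (\<integral>\<^sup>+u. ennreal (exp (- w)) * (ennreal (u powr (- p - 1)) * indicator {d..} u) \<partial>lborel)"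
        using w d_le by (intro nn_integral_cong) (auto simp: indicator_def mult.commute)
      also have "\<dots> = ennreal (exp (- w)) * ennreal (d powr (- p) / p)"
        using d assms by (subst nn_integral_cmult) (auto simp: nn_integral_powr_tail)
      \<comment> \<open>The inner integral contributes \<open>w powr (- p / a)\<close>, and the
        remaining integral over \<open>w\<close> is \<open>Gamma (1 - p / a)\<close>, finite because
        \<open>p < a\<close>.\<close>
      also have "d powr (- p) = c powr (p / a) * w powr (- p / a)"
        using w c by (simp add: d_def powr_powr powr_divide powr_minus field_simps)
      finally show ?thesis
        using w assms a by (simp add: ennreal_mult[symmetric] field_simps)
    qed auto
  qed
  also have "\<dots> = ennreal (c powr (p / a) / p) * ennreal (Gamma (1 - p / a) / 1 powr (1 - p / a))"
  proof (subst nn_integral_cmult)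
    have "has_bochner_integral lborel (\<lambda>w. indicator {0<..} w * (exp (- (1 * w)) * w powr ((1 - p / a) - 1)))
        (Gamma (1 - p / a) / 1 powr (1 - p / a))"
      using assms a by (intro has_bochner_integral_Gamma) auto
    then show "ennreal (c powr (p / a) / p) * (\<integral>\<^sup>+w. ennreal (indicator {0<..} w *
          (exp (- (1 * w)) * w powr ((1 - p / a) - 1))) \<partial>lborel)
        = ennreal (c powr (p / a) / p) * ennreal (Gamma (1 - p / a) / 1 powr (1 - p / a))"
      by (subst nn_integral_eq_integral)
         (auto simp: has_bochner_integral_iff)
  qed simp
  also have "\<dots> = ennreal (c powr (p / a) * (Gamma (1 - p / a) / p))"
    using assms a by (subst ennreal_mult[symmetric]) (auto simp: less_imp_le)
  finally show ?thesis
    using assms a c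
    by (intro has_bochner_integral_nn_integral)
       (auto simp: less_imp_le)
qed

section \<open>Laplace transforms of a nonnegative random variable and of its tail\<close>

lemma (in prob_space) integrable_exp_neg:
  fixes X :: "'a \<Rightarrow> real"
  assumes [measurable]: "random_variable borel X" and nonneg: "AE \<omega> in M. 0 \<le> X \<omega>" and "0 \<le> \<eta>"
  shows "integrable M (\<lambda>\<omega>. exp (- \<eta> * X \<omega>))"
  using nonneg \<open>0 \<le> \<eta>\<close>
  by (intro integrable_const_bound[of _ 1]) (auto elim!: eventually_mono)

text \<open>By Tonelli the integral is the expectation of the integral of
  \<open>exp (- (\<eta> * y))\<close> over \<open>0 < y < X \<omega>\<close>, which equals
  \<open>(1 - exp (- \<eta> * X \<omega>)) / \<eta>\<close>. This turns information on the Laplace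
  transform into information on a monotone function.\<close>

lemma (in prob_space) has_bochner_integral_laplace_tail:
  fixes X :: "'a \<Rightarrow> real" and \<eta> :: real
  assumes X [measurable]: "random_variable borel X" and nonneg: "AE \<omega> in M. 0 \<le> X \<omega>" and "0 < \<eta>"
  shows "has_bochner_integral lborel
    (\<lambda>y. indicator {0<..} y * (exp (- (\<eta> * y)) * prob {\<omega> \<in> space M. y < X \<omega>}))
    ((1 - expectation (\<lambda>\<omega>. exp (- \<eta> * X \<omega>))) / \<eta>)"
proof -
  interpret P: pair_sigma_finite M lborel ..
  let ?f = "\<lambda>y. indicator {0<..} y * (exp (- (\<eta> * y)) * prob {\<omega> \<in> space M. y < X \<omega>})"
  have "(\<integral>\<^sup>+y. ennreal (?f y) \<partial>lborel)
     = (\<integral>\<^sup>+y. \<integral>\<^sup>+\<omega>. (if 0 < y \<and> y < X \<omega> then ennreal (exp (- (\<eta> * y))) else 0) \<partial>M \<partial>lborel)"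
  proof (intro nn_integral_cong)
    fix y :: real
    show "ennreal (?f y) = (\<integral>\<^sup>+\<omega>. (if 0 < y \<and> y < X \<omega> then ennreal (exp (- (\<eta> * y))) else 0) \<partial>M)"
    proof (cases "0 < y")
      case True
      have "(\<integral>\<^sup>+\<omega>. (if 0 < y \<and> y < X \<omega> then ennreal (exp (- (\<eta> * y))) else 0) \<partial>M)
          = (\<integral>\<^sup>+\<omega>. ennreal (exp (- (\<eta> * y))) * indicator {\<omega> \<in> space M. y < X \<omega>} \<omega> \<partial>M)"
        using True by (intro nn_integral_cong) (auto simp: indicator_def)
      also have "\<dots> = ennreal (?f y)"
        using True by (subst nn_integral_cmult_indicator) (auto simp: emeasure_eq_measure ennreal_mult)
      finally show ?thesis ..
    qed auto
  qed
  also have "\<dots> = (\<integral>\<^sup>+\<omega>. \<integral>\<^sup>+y. (if 0 < y \<and> y < X \<omega> then ennreal (exp (- (\<eta> * y))) else 0) \<partial>lborel \<partial>M)"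
    by (rule P.Fubini') measurable
  also have "\<dots> = (\<integral>\<^sup>+\<omega>. ennreal ((1 - exp (- \<eta> * X \<omega>)) / \<eta>) \<partial>M)"
  proof (intro nn_integral_cong_AE, use nonneg in eventually_elim)
    fix \<omega> assume X: "0 \<le> X \<omega>"
    have "(\<integral>\<^sup>+y. (if 0 < y \<and> y < X \<omega> then ennreal (exp (- (\<eta> * y))) else 0) \<partial>lborel)
        = (\<integral>\<^sup>+y. ennreal (exp (- (\<eta> * y))) * indicator {0..X \<omega>} y \<partial>lborel)"
      \<comment> \<open>The open and the closed interval differ in the two endpoints only.\<close>
      by (intro nn_integral_cong_AE,
          use AE_lborel_singleton[of 0] AE_lborel_singleton[of "X \<omega>"] in eventually_elim)
         (auto simp: indicator_def)
    also have "\<dots> = ennreal (- exp (- (\<eta> * X \<omega>)) / \<eta> - (- exp (- (\<eta> * 0)) / \<eta>))"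
      using X \<open>0 < \<eta>\<close>
      by (intro nn_integral_FTC_Icc)
         (auto intro!: derivative_eq_intros simp flip: has_real_derivative_iff_has_vector_derivative)
    finally show "(\<integral>\<^sup>+y. (if 0 < y \<and> y < X \<omega> then ennreal (exp (- (\<eta> * y))) else 0) \<partial>lborel)
        = ennreal ((1 - exp (- \<eta> * X \<omega>)) / \<eta>)"
      by (simp add: diff_divide_distrib)
  qed
  also have "\<dots> = ennreal (expectation (\<lambda>\<omega>. (1 - exp (- \<eta> * X \<omega>)) / \<eta>))"
  proof (rule nn_integral_eq_integral)
    show "integrable M (\<lambda>\<omega>. (1 - exp (- \<eta> * X \<omega>)) / \<eta>)"
      using nonneg \<open>0 < \<eta>\<close>
      by (intro integrable_const_bound[of _ "1 / \<eta>"]) (auto simp: field_simps elim!: eventually_mono)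
    show "AE \<omega> in M. 0 \<le> (1 - exp (- \<eta> * X \<omega>)) / \<eta>"
      using nonneg \<open>0 < \<eta>\<close> by (auto elim!: eventually_mono)
  qed
  also have "expectation (\<lambda>\<omega>. (1 - exp (- \<eta> * X \<omega>)) / \<eta>)
      = (1 - expectation (\<lambda>\<omega>. exp (- \<eta> * X \<omega>))) / \<eta>"
    using integrable_exp_neg[OF X nonneg, of \<eta>] \<open>0 < \<eta>\<close> by (simp add: prob_space)
  finally have *: "(\<integral>\<^sup>+y. ennreal (?f y) \<partial>lborel) = ennreal ((1 - expectation (\<lambda>\<omega>. exp (- \<eta> * X \<omega>))) / \<eta>)" .
  \<comment> \<open>Nonnegativity of the value allows passing from the extended integral back to a
    real one.\<close>
  have "expectation (\<lambda>\<omega>. exp (- \<eta> * X \<omega>)) \<le> 1"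
    using nonneg \<open>0 < \<eta>\<close> integrable_exp_neg[OF X nonneg, of \<eta>]
    by (intro integral_le_const) (auto elim!: eventually_mono)
  then show ?thesis
    using * \<open>0 < \<eta>\<close> by (intro has_bochner_integral_nn_integral) (auto)
qed

subsection \<open>Karamata's Tauberian theorem\<close>

text \<open>\<open>h\<close> is bounded on the compact interval \<open>{0..1}\<close> that contains
  all values of \<open>T\<close>, so a multiple of \<open>v\<close> dominates the product.\<close>

lemma integrable_continuous_mult:
  fixes T v :: "'a \<Rightarrow> real" and h :: "real \<Rightarrow> real"
  assumes [measurable]: "T \<in> borel_measurable M"
    and T: "\<And>y. y \<in> space M \<Longrightarrow> T y \<in> {0..1}"
    and v: "integrable M v" and h: "continuous_on UNIV h"
  shows "integrable M (\<lambda>y. h (T y) * v y)"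
proof -
  have [measurable]: "h \<in> borel_measurable borel"
    using h by (rule borel_measurable_continuous_onI)
  note [measurable] = borel_measurable_integrable[OF v]
  have "compact (h ` {0..1})"
    using h by (intro compact_continuous_image) (auto intro: continuous_on_subset)
  then obtain B where B: "\<And>s. s \<in> {0..1} \<Longrightarrow> \<bar>h s\<bar> \<le> B"
    by (fastforce simp: bounded_iff dest: compact_imp_bounded)
  have "0 \<le> B" using B[of 0] by auto
  show ?thesis
  proof (rule Bochner_Integration.integrable_bound)
    show "integrable M (\<lambda>y. B * v y)" using v by simp
    show "AE y in M. norm (h (T y) * v y) \<le> norm (B * v y)"
      using B[OF T] \<open>0 \<le> B\<close> by (intro AE_I2) (auto simp: abs_mult intro!: mult_right_mono)
  qed measurable
qed

text \<open>Moments determine the limit because, by Weierstrass, \<open>h\<close> is uniformly approximated by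
  polynomials on \<open>[0, 1]\<close>, and the zeroth moments keep the error under control.\<close>

lemma tendsto_integral_of_moments:
  fixes T w :: "'a \<Rightarrow> real" and v :: "'b \<Rightarrow> 'a \<Rightarrow> real" and h :: "real \<Rightarrow> real"
  assumes T_meas: "T \<in> borel_measurable M"
    and T: "\<And>y. y \<in> space M \<Longrightarrow> T y \<in> {0..1}"
    and v: "\<forall>\<^sub>F x in F. integrable M (v x) \<and> (\<forall>y\<in>space M. 0 \<le> v x y)"
    and w: "integrable M w" "\<And>y. y \<in> space M \<Longrightarrow> 0 \<le> w y"
    and moments: "\<And>k::nat. ((\<lambda>x. \<integral>y. T y ^ k * v x y \<partial>M) \<longlongrightarrow> (\<integral>y. T y ^ k * w y \<partial>M)) F"
    and h: "continuous_on UNIV h"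
  shows "((\<lambda>x. \<integral>y. h (T y) * v x y \<partial>M) \<longlongrightarrow> (\<integral>y. h (T y) * w y \<partial>M)) F"
proof (rule tendstoI)
  fix e :: real assume e: "0 < e"
  define m where "m = (\<integral>y. w y \<partial>M)"
  have m: "0 \<le> m" unfolding m_def using w by (intro integral_nonneg_AE AE_I2)
  \<comment> \<open>Three errors have to fit into \<open>e\<close>: at most
    \<open>d * (m + 1)\<close> from replacing \<open>h\<close> by \<open>q\<close> against
    \<open>v x\<close>, less than \<open>d\<close> from the polynomial moments, and at most
    \<open>d * m\<close> from replacing \<open>q\<close> by \<open>h\<close> against
    \<open>w\<close>. The constant \<open>3\<close> leaves room to spare and keeps the denominator
    positive.\<close>
  define d where "d = e / (2 * m + 3)"
  have d: "0 < d" "d * (2 * m + 3) = e" using e m by (auto simp: d_def field_simps)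
  obtain q where q: "real_polynomial_function q" "\<And>s. s \<in> {0..1} \<Longrightarrow> \<bar>h s - q s\<bar> < d"
    using Stone_Weierstrass_real_polynomial_function[OF compact_Icc continuous_on_subset[OF h] d(1)]
    by (metis top_greatest)
  obtain a n where q_eq: "q = (\<lambda>s. \<Sum>i\<le>n. a i * s ^ i)"
    using q(1) unfolding real_polynomial_function_iff_sum by blast
  have q_cont: "continuous_on UNIV q"
    unfolding q_eq by (intro continuous_intros)
  have diff: "\<bar>(\<integral>y. h (T y) * u y \<partial>M) - (\<integral>y. q (T y) * u y \<partial>M)\<bar> \<le> d * (\<integral>y. u y \<partial>M)"
    if u: "integrable M u" "\<And>y. y \<in> space M \<Longrightarrow> 0 \<le> u y" for u
  proof -
    have I: "integrable M (\<lambda>y. h (T y) * u y)" "integrable M (\<lambda>y. q (T y) * u y)"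
      using integrable_continuous_mult[OF T_meas T u(1)] h q_cont by auto
    have "\<bar>\<integral>y. h (T y) * u y - q (T y) * u y \<partial>M\<bar> \<le> (\<integral>y. \<bar>h (T y) * u y - q (T y) * u y\<bar> \<partial>M)"
      by (rule integral_abs_bound)
    also have "\<dots> \<le> (\<integral>y. d * u y \<partial>M)"
    proof (intro integral_mono integrable_abs Bochner_Integration.integrable_diff I integrable_mult_right u(1))
      fix y assume y: "y \<in> space M"
      then show "\<bar>h (T y) * u y - q (T y) * u y\<bar> \<le> d * u y"
        using q(2)[OF T[OF y]] u(2)[OF y]
        by (auto simp: abs_mult intro!: mult_right_mono simp flip: left_diff_distrib)
    qed
    finally show ?thesis using I by simp
  qed
  have poly: "(\<integral>y. q (T y) * u y \<partial>M) = (\<Sum>i\<le>n. a i * (\<integral>y. T y ^ i * u y \<partial>M))"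
    if u: "integrable M u" for u
  proof -
    have int: "integrable M (\<lambda>y. T y ^ i * u y)" for i
      by (rule integrable_continuous_mult[OF T_meas T u]) (assumption | intro continuous_intros)+
    have "(\<integral>y. q (T y) * u y \<partial>M) = (\<integral>y. (\<Sum>i\<le>n. a i * (T y ^ i * u y)) \<partial>M)"
      unfolding q_eq by (simp add: sum_distrib_right mult.assoc)
    also have "\<dots> = (\<Sum>i\<le>n. a i * (\<integral>y. T y ^ i * u y \<partial>M))"
      using int by (subst Bochner_Integration.integral_sum) auto
    finally show ?thesis .
  qed
  have "((\<lambda>x. \<Sum>i\<le>n. a i * (\<integral>y. T y ^ i * v x y \<partial>M)) \<longlongrightarrow> (\<Sum>i\<le>n. a i * (\<integral>y. T y ^ i * w y \<partial>M))) F"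
    by (intro tendsto_intros moments)
  \<comment> \<open>The zeroth moment eventually lies within \<open>1\<close> of \<open>m\<close>,
    which bounds the total mass of \<open>v x\<close> by \<open>m + 1\<close>.\<close>
  from tendstoD[OF this d(1)] tendstoD[OF moments[of 0] zero_less_one] v
  show "\<forall>\<^sub>F x in F. dist (\<integral>y. h (T y) * v x y \<partial>M) (\<integral>y. h (T y) * w y \<partial>M) < e"
  proof eventually_elim
    case (elim x)
    then have v: "integrable M (v x)" "\<And>y. y \<in> space M \<Longrightarrow> 0 \<le> v x y" by auto
    have q_near: "\<bar>(\<integral>y. q (T y) * v x y \<partial>M) - (\<integral>y. q (T y) * w y \<partial>M)\<bar> < d"
      using elim(1) poly[OF v(1)] poly[OF w(1)] by (simp add: dist_real_def)
    have "d * (\<integral>y. v x y \<partial>M) \<le> d * (m + 1)"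
      using elim(2) d(1) by (intro mult_left_mono) (auto simp: dist_real_def m_def)
    with q_near diff[OF v] diff[OF w] d(2) show ?case
      unfolding dist_real_def m_def[symmetric] by (simp add: algebra_simps)
  qed
qed

text \<open>The test function is the positive part of a quadratic in
  \<open>s = exp (- \<bar>y\<bar>)\<close> with roots \<open>exp (- v)\<close> and
  \<open>exp (- u)\<close>. It serves as a continuous substitute for the indicator of
  \<open>(u, v)\<close>, so that convergence of moments applies to it.\<close>

lemma exp_bump:
  fixes u v :: real
  assumes "0 < u" "u < v"
  obtains h :: "real \<Rightarrow> real"
  where "continuous_on UNIV h" "\<And>s. 0 \<le> h s"
    "\<And>y. 0 < y \<Longrightarrow> h (exp (- \<bar>y\<bar>)) \<noteq> 0 \<Longrightarrow> u < y \<and> y < v"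
    "integrable lborel (\<lambda>y. h (exp (- \<bar>y\<bar>)) * (indicator {0<..} y * exp (- y)))"
    "0 < (\<integral>y. h (exp (- \<bar>y\<bar>)) * (indicator {0<..} y * exp (- y)) \<partial>lborel)"
proof
  let ?h = "\<lambda>s::real. max 0 ((s - exp (- v)) * (exp (- u) - s))"
  let ?w = "\<lambda>y. ?h (exp (- \<bar>y\<bar>)) * (indicator {0<..} y * exp (- y))"
  show cont: "continuous_on UNIV ?h" by (intro continuous_intros)
  show "0 \<le> ?h s" for s by simp
  show "u < y \<and> y < v" if "0 < y" "?h (exp (- \<bar>y\<bar>)) \<noteq> 0" for y
  proof -
    have "0 < z" if "max 0 z \<noteq> 0" for z :: real using that by (simp add: max_def split: if_splits)
    from this[OF that(2)] have "0 < (exp (- y) - exp (- v)) * (exp (- u) - exp (- y))"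
      using that by simp
    then show ?thesis using assms by (auto simp: zero_less_mult_iff)
  qed
  have "has_bochner_integral lborel (\<lambda>y::real. indicator {0<..} y * (exp (- (1 * y)) * y powr (1 - 1)))
      (Gamma 1 / 1 powr 1)"
    by (rule has_bochner_integral_Gamma) auto
  also have "(\<lambda>y::real. indicator {0<..} y * (exp (- (1 * y)) * y powr (1 - 1)))
      = (\<lambda>y. indicator {0<..} y * exp (- y))"
    by (auto simp: fun_eq_iff indicator_def)
  finally have "integrable lborel (\<lambda>y::real. indicator {0<..} y * exp (- y))"
    by (rule integrable.intros)
  then show int: "integrable lborel ?w"
    using integrable_continuous_mult[OF _ _ _ cont, of "\<lambda>y. exp (- \<bar>y\<bar>)" lborel] by auto
  have nonneg: "AE y in lborel. 0 \<le> ?w y" by (intro AE_I2) auto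
  \<comment> \<open>The bump is strictly positive on \<open>(u, v)\<close>, so vanishing almost
    everywhere would make this interval a null set.\<close>
  have "\<not> (AE y in lborel. ?w y = 0)"
  proof
    assume "AE y in lborel. ?w y = 0"
    then have "AE y in lborel. y \<notin> {u<..<v}"
    proof eventually_elim
      case (elim y)
      show ?case
      proof
        assume "y \<in> {u<..<v}"
        then have "0 < (exp (- y) - exp (- v)) * (exp (- u) - exp (- y))"
          by (intro mult_pos_pos) auto
        with elim \<open>y \<in> {u<..<v}\<close> assms show False by (auto simp: max_def)
      qed
    qed
    then have "emeasure lborel {u<..<v} = 0"
      by (subst (asm) AE_iff_null_sets[symmetric]) auto
    with assms show False by simp
  qed
  then have "(\<integral>y. ?w y \<partial>lborel) \<noteq> 0"
    using integral_nonneg_eq_0_iff_AE[OF int nonneg] by simp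
  from integral_nonneg_AE[OF nonneg] not_sym[OF this] show "0 < (\<integral>y. ?w y \<partial>lborel)"
    by (rule le_neq_trans)
qed

text \<open>Karamata's argument on the rescaled functions \<open>y \<mapsto> x powr \<alpha> * f (x * y)\<close>. Testing against
  bumps just to the right and just to the left of \<open>1\<close> uses monotonicity and so yields
  the limit of \<open>f\<close> itself rather than of its primitive.\<close>

theorem karamata_tauberian_antimono:
  fixes f :: "real \<Rightarrow> real" and \<alpha> c :: real
  assumes \<alpha>: "\<alpha> < 1"
    and antimono: "\<And>x y. 0 < x \<Longrightarrow> x \<le> y \<Longrightarrow> f y \<le> f x"
    and nonneg: "\<And>x. 0 < x \<Longrightarrow> 0 \<le> f x"
    and int: "\<And>s. 0 < s \<Longrightarrow> integrable lborel (\<lambda>y. indicator {0<..} y * (exp (- (s * y)) * f y))"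
    and lim: "((\<lambda>s. s powr (1 - \<alpha>) * (\<integral>y. indicator {0<..} y * (exp (- (s * y)) * f y) \<partial>lborel))
      \<longlongrightarrow> c) (at_right 0)"
  shows "((\<lambda>x. x powr \<alpha> * f x) \<longlongrightarrow> c / Gamma (1 - \<alpha>)) at_top"
proof -
  define L where "L s = (\<integral>y. indicator {0<..} y * (exp (- (s * y)) * f y) \<partial>lborel)" for s
  define C where "C = c / Gamma (1 - \<alpha>)"
  \<comment> \<open>For \<open>y > 0\<close>, \<open>T y ^ k * exp (- y)\<close> is
    \<open>exp (- (k + 1) * y)\<close>, so the moments of \<open>v x\<close> are Laplace transforms
    of \<open>f\<close> at \<open>(k + 1) / x\<close>, and those of the expected limit
    \<open>w\<close> are Gamma integrals. The absolute value keeps \<open>T\<close> within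
    \<open>{0..1}\<close> on the whole line.\<close>
  define T where "T y = exp (- \<bar>y\<bar>)" for y :: real
  define v where "v x y = indicator {0<..} y * (exp (- y) * (x powr \<alpha> * f (x * y)))" for x y
  define w where "w y = indicator {0<..} y * (exp (- y) * (C * y powr (- \<alpha>)))" for y
  have lim': "((\<lambda>s. s powr (1 - \<alpha>) * L s) \<longlongrightarrow> c) (at_right 0)"
    using lim by (simp add: L_def)
  have "0 \<le> c"
  proof (rule tendsto_lowerbound[OF lim'])
    have "0 \<le> L s" for s
      unfolding L_def by (intro integral_nonneg_AE AE_I2) (auto simp: indicator_def nonneg)
    then show "\<forall>\<^sub>F s in at_right 0. 0 \<le> s powr (1 - \<alpha>) * L s" by simp
  qed auto
  then have "0 \<le> C" using \<alpha> by (simp add: C_def less_imp_le)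
  have T_meas: "T \<in> borel_measurable lborel" unfolding T_def by measurable
  have T01: "T y \<in> {0..1}" for y by (simp add: T_def)
  have v_scale: "integrable lborel (\<lambda>y. T y ^ k * v x y)"
    "(\<integral>y. T y ^ k * v x y \<partial>lborel) = real (Suc k) powr (\<alpha> - 1) *
      ((real (Suc k) / x) powr (1 - \<alpha>) * L (real (Suc k) / x))" if "0 < x" for x k
  proof -
    let ?F = "\<lambda>z. indicator {0<..} z * (exp (- ((real (Suc k) / x) * z)) * f z)"
    have eq: "(\<lambda>y. T y ^ k * v x y) = (\<lambda>y. x powr \<alpha> * ?F (0 + x * y))"
    proof
      fix y
      have "exp (- y) ^ k * exp (- y) = exp (- (real (Suc k) * y))"
        by (simp add: exp_of_nat_mult[symmetric] exp_add[symmetric] algebra_simps)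
      then show "T y ^ k * v x y = x powr \<alpha> * ?F (0 + x * y)"
        using that by (auto simp: T_def v_def indicator_def zero_less_mult_iff)
    qed
    have F: "integrable lborel ?F" using that by (intro int) auto
    then show "integrable lborel (\<lambda>y. T y ^ k * v x y)"
      unfolding eq using that by (intro integrable_mult_right lborel_integrable_real_affine) auto
    have "L (real (Suc k) / x) = x * (\<integral>y. ?F (0 + x * y) \<partial>lborel)"
      unfolding L_def using that by (subst lborel_integral_real_affine[of x _ 0]) auto
    then have "(\<integral>y. T y ^ k * v x y \<partial>lborel) = x powr \<alpha> * (L (real (Suc k) / x) / x)"
      unfolding eq using that by simp
    \<comment> \<open>Splitting off \<open>real (Suc k) powr (\<alpha> - 1)\<close> leaves exactly
      the expression whose limit is assumed, at the point \<open>(k + 1) / x\<close>.\<close>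
    also have "\<dots> = real (Suc k) powr (\<alpha> - 1) *
        ((real (Suc k) / x) powr (1 - \<alpha>) * L (real (Suc k) / x))"
      using that by (simp add: powr_divide powr_diff field_simps del: of_nat_Suc)
    finally show "(\<integral>y. T y ^ k * v x y \<partial>lborel) = real (Suc k) powr (\<alpha> - 1) *
        ((real (Suc k) / x) powr (1 - \<alpha>) * L (real (Suc k) / x))" .
  qed
  have w_moment: "has_bochner_integral lborel (\<lambda>y. T y ^ k * w y) (c * real (Suc k) powr (\<alpha> - 1))" for k
  proof -
    have "has_bochner_integral lborel
        (\<lambda>y. C * (indicator {0<..} y * (exp (- (real (Suc k) * y)) * y powr ((1 - \<alpha>) - 1))))
        (C * (Gamma (1 - \<alpha>) / real (Suc k) powr (1 - \<alpha>)))"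
      using \<alpha> by (intro has_bochner_integral_mult_right has_bochner_integral_Gamma) auto
    also have "(\<lambda>y. C * (indicator {0<..} y * (exp (- (real (Suc k) * y)) * y powr ((1 - \<alpha>) - 1))))
        = (\<lambda>y. T y ^ k * w y)"
    proof
      fix y
      have "exp (- y) ^ k * exp (- y) = exp (- (real (Suc k) * y))"
        by (simp add: exp_of_nat_mult[symmetric] exp_add[symmetric] algebra_simps)
      then show "C * (indicator {0<..} y * (exp (- (real (Suc k) * y)) * y powr ((1 - \<alpha>) - 1)))
          = T y ^ k * w y"
        by (auto simp: T_def w_def indicator_def)
    qed
    also have "C * (Gamma (1 - \<alpha>) / real (Suc k) powr (1 - \<alpha>)) = c * real (Suc k) powr (\<alpha> - 1)"
      using \<alpha> less_imp_neq[OF Gamma_real_pos, of "1 - \<alpha>"]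
      by (simp add: C_def powr_diff field_simps del: of_nat_Suc)
    finally show ?thesis .
  qed
  have v_int: "integrable lborel (v x)" if "0 < x" for x
    using v_scale(1)[OF that, of 0] by simp
  have v_nonneg: "0 \<le> v x y" if "0 < x" for x y
    using that by (auto simp: v_def indicator_def nonneg)
  have w_int: "integrable lborel w"
    using w_moment[of 0] by (simp add: has_bochner_integral_iff)
  have moments: "((\<lambda>x. \<integral>y. T y ^ k * v x y \<partial>lborel) \<longlongrightarrow> (\<integral>y. T y ^ k * w y \<partial>lborel)) at_top" for k
  proof -
    have "filterlim (\<lambda>x. real (Suc k) / x) (at_right 0) at_top" by real_asymp
    from filterlim_compose[OF lim' this]
    have "((\<lambda>x. real (Suc k) powr (\<alpha> - 1) * ((real (Suc k) / x) powr (1 - \<alpha>) * L (real (Suc k) / x)))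
        \<longlongrightarrow> real (Suc k) powr (\<alpha> - 1) * c) at_top"
      by (rule tendsto_mult_left)
    moreover have "\<forall>\<^sub>F x in at_top. real (Suc k) powr (\<alpha> - 1) *
          ((real (Suc k) / x) powr (1 - \<alpha>) * L (real (Suc k) / x)) = (\<integral>y. T y ^ k * v x y \<partial>lborel)"
      using eventually_gt_at_top[of 0] by eventually_elim (simp only: v_scale(2))
    ultimately show ?thesis
      using w_moment[of k] by (auto simp: has_bochner_integral_iff mult.commute elim: Lim_transform_eventually)
  qed
  have test: "((\<lambda>x. \<integral>y. h (T y) * v x y \<partial>lborel) \<longlongrightarrow> (\<integral>y. h (T y) * w y \<partial>lborel)) at_top"
    if "continuous_on UNIV h" for h
    by (rule tendsto_integral_of_moments[OF T_meas T01 _ w_int _ moments that])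
       (use \<open>0 \<le> C\<close> in \<open>auto simp: w_def v_int v_nonneg intro: eventually_mono[OF eventually_gt_at_top[of 0]]\<close>)
  have lim_C: "((\<lambda>y. C * y powr (- \<alpha>)) \<longlongrightarrow> C) (at 1)"
    by (auto intro!: tendsto_eq_intros)
  note int_v = integrable_continuous_mult[OF T_meas T01 v_int]
  note int_w = integrable_continuous_mult[OF T_meas T01 w_int]
  show ?thesis unfolding C_def[symmetric]
  proof (rule order_tendstoI)
    fix a assume "a < C"
    then obtain a' where a': "a < a'" "a' < C" using dense by blast
    \<comment> \<open>The lower bound uses a bump on \<open>(1, b)\<close>. There
      \<open>f (x * y) \<le> f x\<close>, so \<open>x powr \<alpha> * f x\<close> is at least the
      bump average of \<open>x powr \<alpha> * f (x * y)\<close>, whose limit is at least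
      \<open>a'\<close> and hence exceeds \<open>a\<close>.\<close>
    from lim_C a'(2) have "\<forall>\<^sub>F y in at_right 1. a' < C * y powr (- \<alpha>)"
      by (intro order_tendstoD(1)) (auto intro: filterlim_mono at_le)
    then obtain b where b: "1 < b" "\<And>y. 1 < y \<Longrightarrow> y < b \<Longrightarrow> a' < C * y powr (- \<alpha>)"
      by (auto simp: eventually_at_right_field)
    obtain h where h: "continuous_on UNIV h" "\<And>s. 0 \<le> h s"
      "\<And>y. 0 < y \<Longrightarrow> h (T y) \<noteq> 0 \<Longrightarrow> 1 < y \<and> y < b"
      "integrable lborel (\<lambda>y. h (T y) * (indicator {0<..} y * exp (- y)))"
      "0 < (\<integral>y. h (T y) * (indicator {0<..} y * exp (- y)) \<partial>lborel)"
      by (rule exp_bump[of 1 b, folded T_def, OF zero_less_one b(1)]) (rule that)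
    define W where "W = (\<integral>y. h (T y) * (indicator {0<..} y * exp (- y)) \<partial>lborel)"
    have W: "0 < W" using h(5) by (simp add: W_def)
    have "a * W < a' * W" using a' W by simp
    also have "\<dots> = (\<integral>y. a' * (h (T y) * (indicator {0<..} y * exp (- y))) \<partial>lborel)"
      by (simp add: W_def)
    also have "\<dots> \<le> (\<integral>y. h (T y) * w y \<partial>lborel)"
    proof (intro integral_mono integrable_mult_right h(4) int_w[OF h(1)])
      fix y
      show "a' * (h (T y) * (indicator {0<..} y * exp (- y))) \<le> h (T y) * w y"
      proof (cases "0 < y \<and> h (T y) \<noteq> 0")
        case True
        then have "a' \<le> C * y powr (- \<alpha>)" using h(3) b(2) by (auto intro: less_imp_le)
        then have "(h (T y) * exp (- y)) * a' \<le> (h (T y) * exp (- y)) * (C * y powr (- \<alpha>))"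
          by (rule mult_left_mono) (simp add: h(2))
        with True show ?thesis by (simp add: w_def mult_ac)
      qed (auto simp: w_def)
    qed
    finally have "\<forall>\<^sub>F x in at_top. a * W < (\<integral>y. h (T y) * v x y \<partial>lborel)"
      by (rule order_tendstoD(1)[OF test[OF h(1)]])
    then show "\<forall>\<^sub>F x in at_top. a < x powr \<alpha> * f x"
      using eventually_gt_at_top[of 0]
    proof eventually_elim
      case (elim x)
      note elim(1)
      also have "(\<integral>y. h (T y) * v x y \<partial>lborel)
          \<le> (\<integral>y. (x powr \<alpha> * f x) * (h (T y) * (indicator {0<..} y * exp (- y))) \<partial>lborel)"
      proof (intro integral_mono integrable_mult_right h(4) int_v[OF elim(2) h(1)])
        fix y
        show "h (T y) * v x y \<le> (x powr \<alpha> * f x) * (h (T y) * (indicator {0<..} y * exp (- y)))"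
        proof (cases "0 < y \<and> h (T y) \<noteq> 0")
          case True
          then have "x powr \<alpha> * f (x * y) \<le> x powr \<alpha> * f x"
            using h(3)[of y] elim by (intro mult_left_mono antimono) auto
          then have "(h (T y) * exp (- y)) * (x powr \<alpha> * f (x * y)) \<le> (h (T y) * exp (- y)) * (x powr \<alpha> * f x)"
            by (rule mult_left_mono) (simp add: h(2))
          with True show ?thesis by (simp add: v_def mult_ac)
        qed (auto simp: v_def)
      qed
      also have "\<dots> = (x powr \<alpha> * f x) * W" by (simp add: W_def)
      finally show ?case using W by simp
    qed
  next
    fix a assume "C < a"
    then obtain a' where a': "C < a'" "a' < a" using dense by blast
    \<comment> \<open>The upper bound is the mirror image: to the left of \<open>1\<close> one has
      \<open>f x \<le> f (x * y)\<close>, so the bump average bounds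
      \<open>x powr \<alpha> * f x\<close> from above.\<close>
    from lim_C a'(1) have "\<forall>\<^sub>F y in at_left 1. C * y powr (- \<alpha>) < a'"
      by (intro order_tendstoD(2)) (auto intro: filterlim_mono at_le)
    then obtain b0 where b0: "b0 < 1" "\<And>y. b0 < y \<Longrightarrow> y < 1 \<Longrightarrow> C * y powr (- \<alpha>) < a'"
      by (auto simp: eventually_at_left_field)
    \<comment> \<open>The maximum with \<open>1 / 2\<close> keeps the support of the bump inside the
      positive half-line.\<close>
    define b where "b = max b0 (1 / 2)"
    have b: "0 < b" "b < 1" "\<And>y. b < y \<Longrightarrow> y < 1 \<Longrightarrow> C * y powr (- \<alpha>) < a'"
      using b0 by (auto simp: b_def)
    obtain h where h: "continuous_on UNIV h" "\<And>s. 0 \<le> h s"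
      "\<And>y. 0 < y \<Longrightarrow> h (T y) \<noteq> 0 \<Longrightarrow> b < y \<and> y < 1"
      "integrable lborel (\<lambda>y. h (T y) * (indicator {0<..} y * exp (- y)))"
      "0 < (\<integral>y. h (T y) * (indicator {0<..} y * exp (- y)) \<partial>lborel)"
      by (rule exp_bump[of b 1, folded T_def, OF b(1,2)]) (rule that)
    define W where "W = (\<integral>y. h (T y) * (indicator {0<..} y * exp (- y)) \<partial>lborel)"
    have W: "0 < W" using h(5) by (simp add: W_def)
    have "(\<integral>y. h (T y) * w y \<partial>lborel)
        \<le> (\<integral>y. a' * (h (T y) * (indicator {0<..} y * exp (- y))) \<partial>lborel)"
    proof (intro integral_mono integrable_mult_right h(4) int_w[OF h(1)])
      fix y
      show "h (T y) * w y \<le> a' * (h (T y) * (indicator {0<..} y * exp (- y)))"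
      proof (cases "0 < y \<and> h (T y) \<noteq> 0")
        case True
        then have "C * y powr (- \<alpha>) \<le> a'" using h(3) b(3) by (auto intro: less_imp_le)
        then have "(h (T y) * exp (- y)) * (C * y powr (- \<alpha>)) \<le> (h (T y) * exp (- y)) * a'"
          by (rule mult_left_mono) (simp add: h(2))
        with True show ?thesis by (simp add: w_def mult_ac)
      qed (auto simp: w_def)
    qed
    also have "\<dots> = a' * W" by (simp add: W_def)
    also have "\<dots> < a * W" using a' W by simp
    finally have "\<forall>\<^sub>F x in at_top. (\<integral>y. h (T y) * v x y \<partial>lborel) < a * W"
      by (rule order_tendstoD(2)[OF test[OF h(1)]])
    then show "\<forall>\<^sub>F x in at_top. x powr \<alpha> * f x < a"
      using eventually_gt_at_top[of 0]
    proof eventually_elim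
      case (elim x)
      have "(x powr \<alpha> * f x) * W
          = (\<integral>y. (x powr \<alpha> * f x) * (h (T y) * (indicator {0<..} y * exp (- y))) \<partial>lborel)"
        by (simp add: W_def)
      also have "\<dots> \<le> (\<integral>y. h (T y) * v x y \<partial>lborel)"
      proof (intro integral_mono integrable_mult_right h(4) int_v[OF elim(2) h(1)])
        fix y
        show "(x powr \<alpha> * f x) * (h (T y) * (indicator {0<..} y * exp (- y))) \<le> h (T y) * v x y"
        proof (cases "0 < y \<and> h (T y) \<noteq> 0")
          case True
          then have "x powr \<alpha> * f x \<le> x powr \<alpha> * f (x * y)"
            using h(3)[of y] elim by (intro mult_left_mono antimono) auto
          then have "(h (T y) * exp (- y)) * (x powr \<alpha> * f x) \<le> (h (T y) * exp (- y)) * (x powr \<alpha> * f (x * y))"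
            by (rule mult_left_mono) (simp add: h(2))
          with True show ?thesis by (simp add: v_def mult_ac)
        qed (auto simp: v_def)
      qed
      also note elim(1)
      finally show ?case using W by simp
    qed
  qed
qed

subsection \<open>Asymptotics from the Laplace transform\<close>

text \<open>On \<open>{0..s}\<close> the factor \<open>exp (- w)\<close> lies between
  \<open>exp (- s)\<close> and \<open>1\<close>, and \<open>w powr (\<alpha> - 1)\<close> integrates
  to \<open>s powr \<alpha> / \<alpha>\<close>.\<close>

lemma lower_incomplete_gamma_bounds:
  fixes \<alpha> s :: real
  assumes "0 < \<alpha>" "0 \<le> s"
  shows "exp (- s) * s powr \<alpha> \<le> \<alpha> * lower_incomplete_gamma \<alpha> s"
    and "\<alpha> * lower_incomplete_gamma \<alpha> s \<le> s powr \<alpha>"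
proof -
  let ?f = "\<lambda>w. indicator {0..s} w * w powr (\<alpha> - 1)"
  let ?g = "\<lambda>w. indicator {0..s} w * (exp (- w) * w powr (\<alpha> - 1))"
  have "(\<integral>\<^sup>+w. ennreal (?f w) \<partial>lborel) = ennreal (s powr \<alpha> / \<alpha>)"
    using assms has_integral_powr_from_0[of "\<alpha> - 1" s]
    by (subst nn_integral_has_integral_lebesgue[symmetric]) auto
  then have f: "has_bochner_integral lborel ?f (s powr \<alpha> / \<alpha>)"
    using assms by (intro has_bochner_integral_nn_integral) auto
  then have f_int: "integrable lborel ?f" and f_eq: "(\<integral>w. ?f w \<partial>lborel) = s powr \<alpha> / \<alpha>"
    by (auto simp: has_bochner_integral_iff)
  have g_int: "integrable lborel ?g"
    by (rule Bochner_Integration.integrable_bound[OF f_int])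
       (auto simp: indicator_def mult_left_le_one_le)
  have lig: "lower_incomplete_gamma \<alpha> s = (\<integral>w. ?g w \<partial>lborel)"
    by (simp add: lower_incomplete_gamma_def set_lebesgue_integral_def)
  have "(\<integral>w. exp (- s) * ?f w \<partial>lborel) \<le> (\<integral>w. ?g w \<partial>lborel)"
    using f_int g_int
    by (intro integral_mono integrable_mult_right) (auto simp: indicator_def intro!: mult_right_mono)
  then show "exp (- s) * s powr \<alpha> \<le> \<alpha> * lower_incomplete_gamma \<alpha> s"
    using assms f_eq lig by (simp add: field_simps)
  have "(\<integral>w. ?g w \<partial>lborel) \<le> (\<integral>w. ?f w \<partial>lborel)"
    using f_int g_int
    by (intro integral_mono) (auto simp: indicator_def mult_left_le_one_le)
  then show "\<alpha> * lower_incomplete_gamma \<alpha> s \<le> s powr \<alpha>"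
    using assms f_eq lig by (simp add: field_simps)
qed

text \<open>\<open>1 - exp (- t * z)\<close> is increasing in \<open>z\<close>, so the two bounds on
  the exponent squeeze the expression between functions with the same limit
  \<open>t\<close>.\<close>

lemma lower_incomplete_gamma_near_zero:
  fixes \<alpha> t :: real
  assumes "0 < \<alpha>" "0 \<le> t"
  shows "((\<lambda>s. s powr (- \<alpha>) * (1 - exp (- t * (\<alpha> * lower_incomplete_gamma \<alpha> s)))) \<longlongrightarrow> t) (at_right 0)"
proof (cases "t = 0")
  case False
  with assms have t: "0 < t" by simp
  show ?thesis
  proof (rule tendsto_sandwich)
    show "((\<lambda>s. s powr (- \<alpha>) * (1 - exp (- t * (exp (- s) * s powr \<alpha>)))) \<longlongrightarrow> t) (at_right 0)"
      using assms t by real_asymp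
    show "((\<lambda>s. s powr (- \<alpha>) * (1 - exp (- t * s powr \<alpha>))) \<longlongrightarrow> t) (at_right 0)"
      using assms t by real_asymp
    show "\<forall>\<^sub>F s in at_right 0. s powr (- \<alpha>) * (1 - exp (- t * (exp (- s) * s powr \<alpha>)))
        \<le> s powr (- \<alpha>) * (1 - exp (- t * (\<alpha> * lower_incomplete_gamma \<alpha> s)))"
      using eventually_at_right_less[of 0] t lower_incomplete_gamma_bounds(1)[OF assms(1)]
      by (auto elim!: eventually_mono intro!: mult_left_mono)
    show "\<forall>\<^sub>F s in at_right 0. s powr (- \<alpha>) * (1 - exp (- t * (\<alpha> * lower_incomplete_gamma \<alpha> s)))
        \<le> s powr (- \<alpha>) * (1 - exp (- t * s powr \<alpha>))"
      using eventually_at_right_less[of 0] t lower_incomplete_gamma_bounds(2)[OF assms(1)]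
      by (auto elim!: eventually_mono intro!: mult_left_mono)
  qed
qed simp

section \<open>Tail, mean and fractional moments of one nonnegative variable\<close>

context prob_space
begin

text \<open>The tail is nonnegative and decreasing, and its Laplace transform at \<open>s\<close> is
  \<open>(1 - expectation (\<lambda>\<omega>. exp (- s * X \<omega>))) / s\<close>. The extra
  division by \<open>s\<close> turns \<open>s powr (- \<alpha>)\<close> into the normalisation
  \<open>s powr (1 - \<alpha>)\<close> of Karamata's theorem.\<close>

lemma tail_asymptotics_of_laplace:
  fixes X :: "'a \<Rightarrow> real" and \<alpha> c :: real
  assumes X [measurable]: "random_variable borel X" and nonneg: "AE \<omega> in M. 0 \<le> X \<omega>"
    and "\<alpha> < 1"
    and lim: "((\<lambda>s. s powr (- \<alpha>) * (1 - expectation (\<lambda>\<omega>. exp (- s * X \<omega>)))) \<longlongrightarrow> c) (at_right 0)"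
  shows "((\<lambda>x. x powr \<alpha> * prob {\<omega> \<in> space M. x < X \<omega>}) \<longlongrightarrow> c / Gamma (1 - \<alpha>)) at_top"
proof (rule karamata_tauberian_antimono)
  note tail = has_bochner_integral_laplace_tail[OF X nonneg]
  show "prob {\<omega> \<in> space M. y < X \<omega>} \<le> prob {\<omega> \<in> space M. x < X \<omega>}" if "x \<le> y" for x y
    using that by (intro finite_measure_mono) auto
  show "integrable lborel (\<lambda>y. indicator {0<..} y * (exp (- (s * y)) * prob {\<omega> \<in> space M. y < X \<omega>}))"
    if "0 < s" for s using tail[OF that] by (simp add: has_bochner_integral_iff)
  have "\<forall>\<^sub>F s in at_right 0. s powr (- \<alpha>) * (1 - expectation (\<lambda>\<omega>. exp (- s * X \<omega>))) = s powr (1 - \<alpha>) *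
      (\<integral>y. indicator {0<..} y * (exp (- (s * y)) * prob {\<omega> \<in> space M. y < X \<omega>}) \<partial>lborel)"
    using eventually_at_right_less[of 0]
  proof eventually_elim
    case (elim s)
    then show ?case
      using tail[OF elim] by (simp add: has_bochner_integral_iff powr_diff powr_minus divide_inverse)
  qed
  with lim show "((\<lambda>s. s powr (1 - \<alpha>) *
      (\<integral>y. indicator {0<..} y * (exp (- (s * y)) * prob {\<omega> \<in> space M. y < X \<omega>}) \<partial>lborel)) \<longlongrightarrow> c) (at_right 0)"
    by (rule Lim_transform_eventually)
qed (use assms in auto)

text \<open>The quotients \<open>(1 - exp (- s * X \<omega>)) / s\<close> converge to
  \<open>X \<omega>\<close> and almost surely lie between \<open>0\<close> and
  \<open>X \<omega>\<close>. Fatou's lemma first yields integrability of \<open>X\<close>; only then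
  can \<open>X\<close> dominate the quotients and the limit \<open>m\<close> be identified as the
  mean.\<close>

lemma expectation_of_laplace:
  fixes X :: "'a \<Rightarrow> real"
  assumes X [measurable]: "random_variable borel X" and nonneg: "AE \<omega> in M. 0 \<le> X \<omega>"
    and lim: "((\<lambda>s. (1 - expectation (\<lambda>\<omega>. exp (- s * X \<omega>))) / s) \<longlongrightarrow> m) (at_right 0)"
  shows "has_bochner_integral M X m"
proof -
  \<comment> \<open>A sequence decreasing to \<open>0\<close> makes Fatou's lemma and dominated
    convergence applicable.\<close>
  define s where "s n = inverse (real (Suc n))" for n
  have s_pos: "0 < s n" for n by (simp add: s_def)
  have "s \<longlonglongrightarrow> 0" unfolding s_def by (rule LIMSEQ_inverse_real_of_nat)
  then have s_lim: "filterlim s (at_right 0) sequentially"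
    by (intro filterlim_at_withinI) (auto simp: s_pos)
  define Y where "Y n \<omega> = (1 - exp (- s n * X \<omega>)) / s n" for n \<omega>
  have [measurable]: "random_variable borel (Y n)" for n unfolding Y_def by measurable
  have Y_int: "integrable M (Y n)" for n
    unfolding Y_def using integrable_exp_neg[OF X nonneg] s_pos[of n] by (simp add: less_imp_le)
  have Y_eq: "expectation (Y n) = (1 - expectation (\<lambda>\<omega>. exp (- s n * X \<omega>))) / s n" for n
    unfolding Y_def using integrable_exp_neg[OF X nonneg, of "s n"] s_pos[of n]
    by (simp add: less_imp_le prob_space)
  have EY: "(\<lambda>n. expectation (Y n)) \<longlonglongrightarrow> m"
    unfolding Y_eq by (rule filterlim_compose[OF lim s_lim])
  have Y_lim: "(\<lambda>n. Y n \<omega>) \<longlonglongrightarrow> X \<omega>" for \<omega>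
  proof -
    have "((\<lambda>s. (1 - exp (- s * X \<omega>)) / s) \<longlongrightarrow> X \<omega>) (at_right 0)"
    proof -
      have "((\<lambda>s. 1 - exp (- s * X \<omega>)) has_real_derivative X \<omega>) (at 0)"
        by (auto intro!: derivative_eq_intros)
      then have "((\<lambda>s. (1 - exp (- s * X \<omega>)) / s) \<longlongrightarrow> X \<omega>) (at 0)"
        by (simp add: DERIV_def)
      then show ?thesis by (rule filterlim_mono) (auto intro: at_le)
    qed
    from filterlim_compose[OF this s_lim] show ?thesis by (simp add: Y_def)
  qed
  have Y_nonneg: "AE \<omega> in M. 0 \<le> Y n \<omega>" for n
    using nonneg by eventually_elim (use s_pos[of n] in \<open>auto simp: Y_def\<close>)
  have Y_le: "AE \<omega> in M. norm (Y n \<omega>) \<le> X \<omega>" for n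
    using nonneg Y_nonneg[of n]
  proof eventually_elim
    case (elim \<omega>)
    have "1 - exp (- s n * X \<omega>) \<le> s n * X \<omega>" using exp_ge_add_one_self[of "- s n * X \<omega>"] by simp
    with elim show ?case using s_pos[of n] by (simp add: Y_def field_simps)
  qed
  have "(\<integral>\<^sup>+\<omega>. ennreal (X \<omega>) \<partial>M) = (\<integral>\<^sup>+\<omega>. liminf (\<lambda>n. ennreal (Y n \<omega>)) \<partial>M)"
    by (intro nn_integral_cong lim_imp_Liminf[symmetric] tendsto_ennrealI Y_lim) simp
  \<comment> \<open>Fatou's lemma, with the convergent expectations on the right, bounds the
    integral of \<open>X\<close> by \<open>m\<close>.\<close>
  also have "\<dots> \<le> liminf (\<lambda>n. \<integral>\<^sup>+\<omega>. ennreal (Y n \<omega>) \<partial>M)"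
    by (rule nn_integral_liminf) simp
  also have "\<dots> = liminf (\<lambda>n. ennreal (expectation (Y n)))"
    by (simp add: nn_integral_eq_integral Y_int Y_nonneg)
  also have "\<dots> = ennreal m"
    by (intro lim_imp_Liminf tendsto_ennrealI EY) simp
  finally have "(\<integral>\<^sup>+\<omega>. ennreal (X \<omega>) \<partial>M) < \<infinity>" by (auto intro: order.strict_trans1)
  then have X_int: "integrable M X"
    using nonneg by (intro integrableI_nonneg) auto
  have "(\<lambda>n. expectation (Y n)) \<longlonglongrightarrow> expectation X"
    by (rule integral_dominated_convergence[where w = X]) (use X_int Y_lim Y_le in auto)
  with EY X_int show ?thesis
    by (auto simp: has_bochner_integral_iff dest: LIMSEQ_unique)
qed

text \<open>Apply the integral representation of \<open>c powr p\<close> with exponent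
  \<open>a = 1\<close> to \<open>c = X \<omega>\<close> and exchange expectation and integral by
  Tonelli. Finiteness of the moment thus follows from integrability on the Laplace side.\<close>

lemma fractional_moment_of_laplace:
  fixes X :: "'a \<Rightarrow> real"
  assumes X [measurable]: "random_variable borel X" and nonneg: "AE \<omega> in M. 0 \<le> X \<omega>"
    and p: "0 < p" "p < 1"
    and I: "has_bochner_integral lborel (\<lambda>u. indicator {0<..} u *
      ((1 - expectation (\<lambda>\<omega>. exp (- u * X \<omega>))) * u powr (- p - 1))) I"
  shows "has_bochner_integral M (\<lambda>\<omega>. X \<omega> powr p) (p / Gamma (1 - p) * I)"
proof -
  interpret P: pair_sigma_finite M lborel ..
  \<comment> \<open>\<open>G\<close> is the integral of
    \<open>(1 - exp (- u)) * u powr (- p - 1)\<close> over \<open>u > 0\<close>, finite since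
    \<open>0 < p < 1\<close>.\<close>
  define G where "G = Gamma (1 - p) / p"
  have G: "0 < G" "0 < Gamma (1 - p)" using p by (simp_all add: G_def)
  have L_le: "expectation (\<lambda>\<omega>. exp (- u * X \<omega>)) \<le> 1" if "0 < u" for u
    using nonneg that integrable_exp_neg[OF X nonneg, of u]
    by (intro integral_le_const) (auto elim!: eventually_mono)
  have I_nonneg: "AE u in lborel. 0 \<le> indicator {0<..} u *
      ((1 - expectation (\<lambda>\<omega>. exp (- u * X \<omega>))) * u powr (- p - 1))"
    using L_le by (intro AE_I2) (auto simp: indicator_def)
  have "(\<integral>\<^sup>+\<omega>. ennreal (X \<omega> powr p) \<partial>M) * ennreal G = (\<integral>\<^sup>+\<omega>. ennreal (X \<omega> powr p * G) \<partial>M)"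
    using G by (simp add: nn_integral_multc ennreal_mult)
  also have "\<dots> = (\<integral>\<^sup>+\<omega>. \<integral>\<^sup>+u. ennreal (indicator {0<..} u *
      ((1 - exp (- (X \<omega> * u powr 1))) * u powr (- p - 1))) \<partial>lborel \<partial>M)"
  proof (intro nn_integral_cong_AE, use nonneg in eventually_elim)
    fix \<omega> assume "0 \<le> X \<omega>"
    with p have "has_bochner_integral lborel (\<lambda>u. indicator {0<..} u *
      ((1 - exp (- (X \<omega> * u powr 1))) * u powr (- p - 1))) (X \<omega> powr (p / 1) * (Gamma (1 - p / 1) / p))"
      by (intro has_bochner_integral_one_minus_exp_powr) auto
    then show "ennreal (X \<omega> powr p * G) = (\<integral>\<^sup>+u. ennreal (indicator {0<..} u *
      ((1 - exp (- (X \<omega> * u powr 1))) * u powr (- p - 1))) \<partial>lborel)"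
      using \<open>0 \<le> X \<omega>\<close>
      by (subst nn_integral_eq_integral) (auto simp: has_bochner_integral_iff G_def indicator_def)
  qed
  also have "\<dots> = (\<integral>\<^sup>+u. \<integral>\<^sup>+\<omega>. ennreal (indicator {0<..} u *
      ((1 - exp (- (X \<omega> * u powr 1))) * u powr (- p - 1))) \<partial>M \<partial>lborel)"
    by (rule P.Fubini'[symmetric]) measurable
  also have "\<dots> = (\<integral>\<^sup>+u. ennreal (indicator {0<..} u *
      ((1 - expectation (\<lambda>\<omega>. exp (- u * X \<omega>))) * u powr (- p - 1))) \<partial>lborel)"
  proof (intro nn_integral_cong)
    fix u :: real
    show "(\<integral>\<^sup>+\<omega>. ennreal (indicator {0<..} u * ((1 - exp (- (X \<omega> * u powr 1))) * u powr (- p - 1))) \<partial>M)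
        = ennreal (indicator {0<..} u *
            ((1 - expectation (\<lambda>\<omega>. exp (- u * X \<omega>))) * u powr (- p - 1)))"
    proof (cases "0 < u")
      case True
      have int: "integrable M (\<lambda>\<omega>. exp (- u * X \<omega>))"
        using True by (intro integrable_exp_neg[OF X nonneg]) auto
      have "(\<integral>\<^sup>+\<omega>. ennreal (indicator {0<..} u * ((1 - exp (- (X \<omega> * u powr 1))) * u powr (- p - 1))) \<partial>M)
          = (\<integral>\<^sup>+\<omega>. ennreal ((1 - exp (- u * X \<omega>)) * u powr (- p - 1)) \<partial>M)"
        using True by (intro nn_integral_cong) (simp add: mult.commute)
      also have "\<dots> = ennreal (expectation (\<lambda>\<omega>. (1 - exp (- u * X \<omega>)) * u powr (- p - 1)))"
        using int nonneg True by (intro nn_integral_eq_integral) (auto elim!: eventually_mono)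
      also have "expectation (\<lambda>\<omega>. (1 - exp (- u * X \<omega>)) * u powr (- p - 1))
          = (1 - expectation (\<lambda>\<omega>. exp (- u * X \<omega>))) * u powr (- p - 1)"
        using int by (simp add: prob_space)
      finally show ?thesis using True by simp
    qed auto
  qed
  also have "\<dots> = ennreal I"
    using I by (subst nn_integral_eq_integral[OF _ I_nonneg]) (auto simp: has_bochner_integral_iff)
  finally have *: "(\<integral>\<^sup>+\<omega>. ennreal (X \<omega> powr p) \<partial>M) * ennreal G = ennreal I" .
  have "0 \<le> I"
    using I integral_nonneg_AE[OF I_nonneg] by (simp add: has_bochner_integral_iff)
  have "(\<integral>\<^sup>+\<omega>. ennreal (X \<omega> powr p) \<partial>M) = (\<integral>\<^sup>+\<omega>. ennreal (X \<omega> powr p) \<partial>M) * (ennreal G * ennreal (1 / G))"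
    using G by (simp flip: ennreal_mult)
  \<comment> \<open>\<open>G\<close> is cancelled by multiplying with \<open>1 / G\<close>, as the
    moment is so far only an extended nonnegative number.\<close>
  also have "\<dots> = ennreal I * ennreal (1 / G)"
    unfolding mult.assoc[symmetric] * ..
  also have "\<dots> = ennreal (p / Gamma (1 - p) * I)"
    using p G \<open>0 \<le> I\<close> by (subst ennreal_mult[symmetric]) (simp_all add: G_def mult.commute less_imp_le)
  finally show ?thesis
    using \<open>0 \<le> I\<close> p by (intro has_bochner_integral_nn_integral) (auto simp: less_imp_le)
qed

end

text \<open>With \<open>z = t powr (- 1 / \<alpha>) * u\<close> one has \<open>t * \<phi> z = u powr
  \<alpha> * (\<phi> z / z powr \<alpha>)\<close>, which tends to \<open>u powr \<alpha>\<close> and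
  never exceeds it. The limit integrand is therefore its own majorant, integrable because
  \<open>p < \<alpha>\<close>.\<close>

lemma tendsto_rescaled_moment_integral:
  fixes \<alpha> p :: real and \<phi> :: "real \<Rightarrow> real" and L :: "real \<Rightarrow> real \<Rightarrow> real"
  assumes p: "0 < p" "p < \<alpha>"
    and L_meas [measurable]: "\<And>t. 0 \<le> t \<Longrightarrow> L t \<in> borel_measurable borel"
    and L: "\<And>t u. 0 \<le> t \<Longrightarrow> 0 < u \<Longrightarrow> L t u = exp (- t * \<phi> u)"
    and \<phi>: "\<And>u. 0 < u \<Longrightarrow> 0 \<le> \<phi> u" "\<And>u. 0 < u \<Longrightarrow> \<phi> u \<le> u powr \<alpha>"
    and \<phi>_lim: "((\<lambda>u. \<phi> u / u powr \<alpha>) \<longlongrightarrow> 1) (at_right 0)"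
  shows "((\<lambda>t. \<integral>u. indicator {0<..} u * ((1 - L t (t powr (- 1 / \<alpha>) * u)) * u powr (- p - 1)) \<partial>lborel)
      \<longlongrightarrow> Gamma (1 - p / \<alpha>) / p) at_top"
proof -
  \<comment> \<open>Replacing \<open>t\<close> by \<open>max 1 t\<close> makes measurability and the
    bound hold for every real \<open>t\<close>, and changes nothing for
    \<open>t \<ge> 1\<close>.\<close>
  define s where "s t u = indicator {0<..} u *
      ((1 - L (max 1 t) (max 1 t powr (- 1 / \<alpha>) * u)) * u powr (- p - 1))" for t u :: real
  define w where "w u = indicator {0<..} u * ((1 - exp (- (1 * u powr \<alpha>))) * u powr (- p - 1))" for u :: real
  have "0 < \<alpha>" using p by simp
  have w: "has_bochner_integral lborel w (1 powr (p / \<alpha>) * (Gamma (1 - p / \<alpha>) / p))"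
    unfolding w_def using p by (intro has_bochner_integral_one_minus_exp_powr) auto
  have scaled: "max 1 t * \<phi> (max 1 t powr (- 1 / \<alpha>) * u)
      = u powr \<alpha> * (\<phi> (max 1 t powr (- 1 / \<alpha>) * u) / (max 1 t powr (- 1 / \<alpha>) * u) powr \<alpha>)"
    if "0 < u" for t u
  proof -
    have "(max 1 t powr (- 1 / \<alpha>)) powr \<alpha> = max 1 t powr (- 1)"
      using \<open>0 < \<alpha>\<close> unfolding powr_powr by simp
    then have "(max 1 t powr (- 1 / \<alpha>) * u) powr \<alpha> = u powr \<alpha> / max 1 t"
      using that by (simp add: powr_mult powr_minus divide_inverse)
    then show ?thesis using that by simp
  qed
  have s_eq: "s t u = (1 - exp (- (u powr \<alpha> * (\<phi> (max 1 t powr (- 1 / \<alpha>) * u) /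
      (max 1 t powr (- 1 / \<alpha>) * u) powr \<alpha>)))) * u powr (- p - 1)" if "0 < u" for t u
    using that unfolding scaled[OF that, symmetric] by (simp add: s_def L)
  have "((\<lambda>t. integral\<^sup>L lborel (s t)) \<longlongrightarrow> integral\<^sup>L lborel w) at_top"
  proof (rule integral_dominated_convergence_at_top[where w = w])
    show "w \<in> borel_measurable lborel" unfolding w_def by measurable
    show "s t \<in> borel_measurable lborel" for t
    proof -
      have [measurable]: "L (max 1 t) \<in> borel_measurable borel" by (rule L_meas) simp
      show ?thesis unfolding s_def by measurable
    qed
    show "integrable lborel w" using w by (rule integrable.intros)
    show "AE u in lborel. ((\<lambda>t. s t u) \<longlongrightarrow> w u) at_top"
    proof (intro AE_I2)
      fix u :: real
      show "((\<lambda>t. s t u) \<longlongrightarrow> w u) at_top"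
      proof (cases "0 < u")
        case True
        have "filterlim (\<lambda>t. max 1 t powr (- 1 / \<alpha>) * u) (at_right 0) at_top"
          using True \<open>0 < \<alpha>\<close> by real_asymp
        from filterlim_compose[OF \<phi>_lim this]
        have "((\<lambda>t. s t u) \<longlongrightarrow> (1 - exp (- (u powr \<alpha> * 1))) * u powr (- p - 1)) at_top"
          unfolding s_eq[OF True] by (intro tendsto_intros)
        then show ?thesis using True by (simp add: w_def)
      qed (simp add: s_def w_def)
    qed
    show "\<forall>\<^sub>F t in at_top. AE u in lborel. norm (s t u) \<le> w u"
    proof (intro always_eventually allI AE_I2)
      fix t u :: real
      show "norm (s t u) \<le> w u"
      proof (cases "0 < u")
        case True
        define z where "z = max 1 t powr (- 1 / \<alpha>) * u"
        have z: "0 < z" using True by (simp add: z_def)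
        have "max 1 t * \<phi> z \<le> u powr \<alpha>"
          unfolding scaled[OF True, of t, folded z_def] using \<phi>(1,2)[OF z] z
          by (intro mult_right_le_one_le) auto
        moreover have "0 \<le> max 1 t * \<phi> z" using \<phi>(1)[OF z] by simp
        ultimately show ?thesis
          using True z unfolding s_def w_def z_def[symmetric]
          by (auto simp: L abs_mult intro!: mult_right_mono)
      qed (simp add: s_def w_def)
    qed
  qed
  then have "((\<lambda>t. integral\<^sup>L lborel (s t)) \<longlongrightarrow> Gamma (1 - p / \<alpha>) / p) at_top"
    using w by (simp add: has_bochner_integral_iff)
  moreover have "\<forall>\<^sub>F t in at_top. integral\<^sup>L lborel (s t) =
      (\<integral>u. indicator {0<..} u * ((1 - L t (t powr (- 1 / \<alpha>) * u)) * u powr (- p - 1)) \<partial>lborel)"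
    using eventually_ge_at_top[of 1] by eventually_elim (simp add: s_def[abs_def] max_absorb2)
  ultimately show ?thesis by (rule Lim_transform_eventually)
qed

text \<open>At \<open>p = \<alpha> = 1\<close> both Gamma factors sit at the pole \<open>0\<close>;
  the coefficient is then read as \<open>1\<close>, and the mean is exactly \<open>t\<close>. For
  \<open>p = \<alpha> < 1\<close> only the numerator sits at the pole, and a tail of order
  \<open>x powr (- \<alpha>)\<close> makes the moment infinite at positive times, hence the guard on
  \<open>p = \<alpha>\<close>.\<close>

theorem theorem3:
  fixes \<alpha> :: real and M :: "'a measure" and S :: "real \<Rightarrow> 'a \<Rightarrow> real"
  assumes "0 < \<alpha>" and "\<alpha> \<le> 1"
    and "subordinator M S"
    and "\<And>\<eta> t. \<eta> \<ge> 0 \<Longrightarrow> t \<ge> 0 \<Longrightarrow>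
           integral\<^sup>L M (\<lambda>\<omega>. exp (- \<eta> * S t \<omega>)) = exp (- t * (\<alpha> * lower_incomplete_gamma \<alpha> \<eta>))"
  shows "(\<alpha> < 1 \<longrightarrow>
           (\<forall>t\<ge>0. (\<lambda>x. measure M {\<omega> \<in> space M. S t \<omega> > x})
              \<sim>[at_top] (\<lambda>x. t * x powr (- \<alpha>) / Gamma (1 - \<alpha>)))) \<and>
         (\<forall>p. 0 < p \<and> p \<le> 1 \<and> p \<le> \<alpha> \<and> (p = \<alpha> \<longrightarrow> \<alpha> = 1) \<longrightarrow>
           (\<forall>t\<ge>0. integrable M (\<lambda>\<omega>. S t \<omega> powr p)) \<and>
           (\<lambda>t. integral\<^sup>L M (\<lambda>\<omega>. S t \<omega> powr p))
              \<sim>[at_top] (\<lambda>t. (if p < \<alpha> then Gamma (1 - p / \<alpha>) / Gamma (1 - p) else 1)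
                              * t powr (p / \<alpha>)))"
proof -
  interpret subordinator M S by fact

  \<comment> \<open>The Laplace exponent of the subordinator and its behaviour at zero\<close>
  define \<phi> where "\<phi> \<eta> = \<alpha> * lower_incomplete_gamma \<alpha> \<eta>" for \<eta>
  have laplace: "expectation (\<lambda>\<omega>. exp (- \<eta> * S t \<omega>)) = exp (- t * \<phi> \<eta>)" if "0 \<le> \<eta>" "0 \<le> t" for \<eta> t
    using assms(4)[OF that] by (simp add: \<phi>_def)
  have \<phi>_le: "\<phi> \<eta> \<le> \<eta> powr \<alpha>" and \<phi>_ge: "exp (- \<eta>) * \<eta> powr \<alpha> \<le> \<phi> \<eta>" if "0 \<le> \<eta>" for \<eta>
    using lower_incomplete_gamma_bounds[OF assms(1) that] by (simp_all add: \<phi>_def)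
  have \<phi>_nonneg: "0 \<le> \<phi> \<eta>" if "0 \<le> \<eta>" for \<eta>
    using \<phi>_ge[OF that] by (rule order_trans[rotated]) simp
  have near_zero: "((\<lambda>s. s powr (- \<alpha>) * (1 - exp (- t * \<phi> s))) \<longlongrightarrow> t) (at_right 0)" if "0 \<le> t" for t
    using lower_incomplete_gamma_near_zero[OF assms(1) that] by (simp add: \<phi>_def)
  have \<phi>_lim: "((\<lambda>\<eta>. \<phi> \<eta> / \<eta> powr \<alpha>) \<longlongrightarrow> 1) (at_right 0)"
  proof (rule tendsto_sandwich)
    show "((\<lambda>\<eta>::real. exp (- \<eta>)) \<longlongrightarrow> 1) (at_right 0)" by real_asymp
    show "\<forall>\<^sub>F \<eta> in at_right 0. exp (- \<eta>) \<le> \<phi> \<eta> / \<eta> powr \<alpha>"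
      using eventually_at_right_less[of 0] by eventually_elim (use \<phi>_ge in \<open>simp add: field_simps\<close>)
    show "\<forall>\<^sub>F \<eta> in at_right 0. \<phi> \<eta> / \<eta> powr \<alpha> \<le> 1"
      using eventually_at_right_less[of 0] by eventually_elim (use \<phi>_le in \<open>simp add: field_simps\<close>)
  qed simp
  have S_meas [measurable]: "random_variable borel (S t)" if "0 \<le> t" for t
    using that by (rule random_variable_X)
  \<comment> \<open>Almost every path starts at \<open>0\<close> and is nondecreasing.\<close>
  have S_nonneg: "AE \<omega> in M. 0 \<le> S t \<omega>" if "0 \<le> t" for t
    using start_zero nondecreasing_paths
  proof eventually_elim
    case (elim \<omega>)
    then show ?case using that mono_onD[of "{0..}" "\<lambda>t. S t \<omega>" 0 t] by simp
  qed

  \<comment> \<open>Tail asymptotics at a fixed time\<close>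
  have tail: "(\<lambda>x. prob {\<omega> \<in> space M. S t \<omega> > x}) \<sim>[at_top] (\<lambda>x. t * x powr (- \<alpha>) / Gamma (1 - \<alpha>))"
    if "\<alpha> < 1" "0 \<le> t" for t
  proof (cases "t = 0")
    case True
    \<comment> \<open>At time \<open>0\<close> both sides vanish for all \<open>x \<ge> 0\<close>,
      so the equivalence holds by eventual equality rather than through a quotient.\<close>
    have "prob {\<omega> \<in> space M. S 0 \<omega> > x} = 0" if "0 \<le> x" for x
      using start_zero that by (subst prob_eq_0) (auto elim!: eventually_mono)
    then have "\<forall>\<^sub>F x in at_top. prob {\<omega> \<in> space M. S t \<omega> > x} = t * x powr (- \<alpha>) / Gamma (1 - \<alpha>)"
      using True by (intro eventually_mono[OF eventually_ge_at_top[of 0]]) simp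
    then show ?thesis by (rule asymp_equiv_refl_ev)
  next
    case False
    with that have t: "0 < t" by simp
    have G: "0 < Gamma (1 - \<alpha>)" using that by simp
    have "((\<lambda>x. x powr \<alpha> * prob {\<omega> \<in> space M. x < S t \<omega>}) \<longlongrightarrow> t / Gamma (1 - \<alpha>)) at_top"
    proof (rule tail_asymptotics_of_laplace[OF S_meas S_nonneg that(1)])
      have "\<forall>\<^sub>F s in at_right 0. s powr (- \<alpha>) * (1 - exp (- t * \<phi> s)) =
          s powr (- \<alpha>) * (1 - expectation (\<lambda>\<omega>. exp (- s * S t \<omega>)))"
        using eventually_at_right_less[of 0] by eventually_elim (use that laplace in simp)
      with near_zero[OF that(2)]
      show "((\<lambda>s. s powr (- \<alpha>) * (1 - expectation (\<lambda>\<omega>. exp (- s * S t \<omega>)))) \<longlongrightarrow> t) (at_right 0)"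
        by (rule Lim_transform_eventually)
    qed (use that in auto)
    then have "((\<lambda>x. x powr \<alpha> * prob {\<omega> \<in> space M. x < S t \<omega>} * (Gamma (1 - \<alpha>) / t))
        \<longlongrightarrow> t / Gamma (1 - \<alpha>) * (Gamma (1 - \<alpha>) / t)) at_top"
      by (intro tendsto_intros)
    also have "t / Gamma (1 - \<alpha>) * (Gamma (1 - \<alpha>) / t) = 1" using t G by simp
    also have "(\<lambda>x. x powr \<alpha> * prob {\<omega> \<in> space M. x < S t \<omega>} * (Gamma (1 - \<alpha>) / t))
        = (\<lambda>x. prob {\<omega> \<in> space M. x < S t \<omega>} / (t * x powr (- \<alpha>) / Gamma (1 - \<alpha>)))"
      by (auto simp: fun_eq_iff powr_minus field_simps)
    finally show ?thesis by (rule asymp_equivI')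
  qed

  \<comment> \<open>Moments of order below \<alpha>\<close>
  have moment: "(\<forall>t\<ge>0. integrable M (\<lambda>\<omega>. S t \<omega> powr p)) \<and>
      (\<lambda>t. expectation (\<lambda>\<omega>. S t \<omega> powr p)) \<sim>[at_top]
        (\<lambda>t. Gamma (1 - p / \<alpha>) / Gamma (1 - p) * t powr (p / \<alpha>))"
    if p: "0 < p" "p < \<alpha>" for p
  proof -
    define L where "L t u = expectation (\<lambda>\<omega>. exp (- u * S t \<omega>))" for t u
    \<comment> \<open>\<open>I t\<close> is the integral that represents the moment at time
      \<open>t\<close>; \<open>J t\<close> is the same integral after rescaling \<open>u\<close>,
      with the power of \<open>t\<close> removed.\<close>
    define I where "I t = (\<integral>u. indicator {0<..} u * ((1 - L t u) * u powr (- p - 1)) \<partial>lborel)" for t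
    define J where "J t = (\<integral>u. indicator {0<..} u *
        ((1 - L t (t powr (- 1 / \<alpha>) * u)) * u powr (- p - 1)) \<partial>lborel)" for t
    have L_meas [measurable]: "L t \<in> borel_measurable borel" if [simp]: "0 \<le> t" for t
    proof -
      have [measurable]: "random_variable borel (S t)" by (rule S_meas) simp
      show ?thesis unfolding L_def by measurable
    qed
    have L: "L t u = exp (- t * \<phi> u)" if "0 \<le> t" "0 < u" for t u
      using laplace that by (simp add: L_def)
    have "p < 1" using p assms(2) by simp
    have I_int: "integrable lborel (\<lambda>u. indicator {0<..} u * ((1 - L t u) * u powr (- p - 1)))"
      if t: "0 \<le> t" for t
    \<comment> \<open>The bound \<open>\<phi> u \<le> u powr \<alpha>\<close> reduces integrability
      to the explicit integral with \<open>c = t\<close> and \<open>a = \<alpha>\<close>, finite for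
      \<open>p < \<alpha>\<close>.\<close>
    proof (rule Bochner_Integration.integrable_bound)
      show "integrable lborel (\<lambda>u. indicator {0<..} u * ((1 - exp (- (t * u powr \<alpha>))) * u powr (- p - 1)))"
        using p t by (intro integrable.intros[OF has_bochner_integral_one_minus_exp_powr]) auto
      have [measurable]: "L t \<in> borel_measurable borel" using t by (rule L_meas)
      show "(\<lambda>u. indicator {0<..} u * ((1 - L t u) * u powr (- p - 1))) \<in> borel_measurable lborel"
        by measurable
      show "AE u in lborel. norm (indicator {0<..} u * ((1 - L t u) * u powr (- p - 1)))
          \<le> norm (indicator {0<..} u * ((1 - exp (- (t * u powr \<alpha>))) * u powr (- p - 1)))"
      proof (intro AE_I2)
        fix u :: real
        show "norm (indicator {0<..} u * ((1 - L t u) * u powr (- p - 1)))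
          \<le> norm (indicator {0<..} u * ((1 - exp (- (t * u powr \<alpha>))) * u powr (- p - 1)))"
        proof (cases "0 < u")
          case True
          then have "0 \<le> t * \<phi> u" "t * \<phi> u \<le> t * u powr \<alpha>"
            using t \<phi>_nonneg[of u] \<phi>_le[of u] by (auto intro: mult_left_mono)
          then show ?thesis using True t
            by (auto simp: L abs_mult intro!: mult_right_mono)
        qed simp
      qed
    qed
    have moment: "has_bochner_integral M (\<lambda>\<omega>. S t \<omega> powr p) (p / Gamma (1 - p) * I t)" if "0 \<le> t" for t
      using I_int[OF that]
      by (intro fractional_moment_of_laplace[OF S_meas[OF that] S_nonneg[OF that] p(1) \<open>p < 1\<close>])
         (simp add: I_def L_def has_bochner_integral_iff)
    have I_eq: "I t = t powr (p / \<alpha>) * J t" if "0 < t" for t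
    proof -
      \<comment> \<open>Substituting \<open>c * u\<close> for \<open>u\<close> contributes
        \<open>c\<close> from the Jacobian and \<open>c powr (- p - 1)\<close> from the kernel,
        together \<open>c powr (- p) = t powr (p / \<alpha>)\<close>.\<close>
      define c where "c = t powr (- 1 / \<alpha>)"
      have c: "0 < c" using that by (simp add: c_def)
      have "I t = c * (\<integral>u. indicator {0<..} (0 + c * u) *
          ((1 - L t (0 + c * u)) * (0 + c * u) powr (- p - 1)) \<partial>lborel)"
        unfolding I_def using c by (subst lborel_integral_real_affine[of c _ 0]) auto
      also have "(\<lambda>u. indicator {0<..} (0 + c * u) * ((1 - L t (0 + c * u)) * (0 + c * u) powr (- p - 1)))
          = (\<lambda>u. c powr (- p - 1) * (indicator {0<..} u * ((1 - L t (c * u)) * u powr (- p - 1))))"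
        using c by (auto simp: fun_eq_iff indicator_def zero_less_mult_iff powr_mult)
      also have "c * (\<integral>u. c powr (- p - 1) * (indicator {0<..} u * ((1 - L t (c * u)) * u powr (- p - 1))) \<partial>lborel)
          = c * c powr (- p - 1) * J t"
        by (simp add: J_def c_def)
      also have "c * c powr (- p - 1) = c powr (- p)"
        using c by (simp add: powr_diff)
      also have "\<dots> = t powr (p / \<alpha>)"
        using that by (simp add: c_def powr_powr)
      finally show ?thesis .
    qed
    have "(J \<longlongrightarrow> Gamma (1 - p / \<alpha>) / p) at_top"
      unfolding J_def
      by (rule tendsto_rescaled_moment_integral[where \<phi> = \<phi>])
         (use p L_meas L \<phi>_nonneg \<phi>_le \<phi>_lim in auto)
    then have "((\<lambda>t. J t * (p / Gamma (1 - p / \<alpha>))) \<longlongrightarrow> Gamma (1 - p / \<alpha>) / p * (p / Gamma (1 - p / \<alpha>))) at_top"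
      by (intro tendsto_intros)
    moreover have G: "0 < Gamma (1 - p / \<alpha>)" "0 < Gamma (1 - p)"
      using p \<open>p < 1\<close> by auto
    ultimately have "((\<lambda>t. J t * (p / Gamma (1 - p / \<alpha>))) \<longlongrightarrow> 1) at_top"
      using p by simp
    moreover have "\<forall>\<^sub>F t in at_top. J t * (p / Gamma (1 - p / \<alpha>)) =
        expectation (\<lambda>\<omega>. S t \<omega> powr p) / (Gamma (1 - p / \<alpha>) / Gamma (1 - p) * t powr (p / \<alpha>))"
      using eventually_gt_at_top[of 0]
    proof eventually_elim
      case (elim t)
      have "expectation (\<lambda>\<omega>. S t \<omega> powr p) = p / Gamma (1 - p) * (t powr (p / \<alpha>) * J t)"
        using moment[of t] I_eq[OF elim] elim by (simp add: has_bochner_integral_iff)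
      then show ?case using G elim by (simp add: field_simps)
    qed
    ultimately have "(\<lambda>t. expectation (\<lambda>\<omega>. S t \<omega> powr p)) \<sim>[at_top]
        (\<lambda>t. Gamma (1 - p / \<alpha>) / Gamma (1 - p) * t powr (p / \<alpha>))"
      by (intro asymp_equivI') (rule Lim_transform_eventually)
    with moment show ?thesis by (auto simp: has_bochner_integral_iff)
  qed

  \<comment> \<open>The mean in the case \<alpha> = 1\<close>
  have mean: "has_bochner_integral M (\<lambda>\<omega>. S t \<omega> powr 1) t" if "\<alpha> = 1" "0 \<le> t" for t
  proof -
    have "has_bochner_integral M (S t) t"
    proof (rule expectation_of_laplace[OF S_meas S_nonneg])
      have "\<forall>\<^sub>F s in at_right 0. s powr (- \<alpha>) * (1 - exp (- t * \<phi> s)) =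
          (1 - expectation (\<lambda>\<omega>. exp (- s * S t \<omega>))) / s"
        using eventually_at_right_less[of 0]
        by eventually_elim (use that laplace in \<open>simp add: powr_minus divide_inverse\<close>)
      with near_zero[OF that(2)]
      show "((\<lambda>s. (1 - expectation (\<lambda>\<omega>. exp (- s * S t \<omega>))) / s) \<longlongrightarrow> t) (at_right 0)"
        by (rule Lim_transform_eventually)
    qed (use that in auto)
    \<comment> \<open>\<open>S t \<omega> powr 1\<close> agrees with \<open>S t \<omega>\<close>
      wherever the latter is nonnegative, hence almost surely.\<close>
    moreover have "has_bochner_integral M (\<lambda>\<omega>. S t \<omega> powr 1) t \<longleftrightarrow> has_bochner_integral M (S t) t"
      using S_meas[OF that(2)] S_nonneg[OF that(2)]
      by (intro has_bochner_integral_cong_AE) (auto elim!: eventually_mono)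
    ultimately show ?thesis by simp
  qed
  have mean_asymp: "(\<lambda>t. expectation (\<lambda>\<omega>. S t \<omega> powr 1)) \<sim>[at_top] (\<lambda>t. t powr 1)" if "\<alpha> = 1"
    using mean[OF that]
    by (intro asymp_equiv_refl_ev eventually_mono[OF eventually_ge_at_top[of 0]])
       (simp add: has_bochner_integral_iff)
  show ?thesis
  proof (intro conjI impI allI)
    fix p assume p: "0 < p \<and> p \<le> 1 \<and> p \<le> \<alpha> \<and> (p = \<alpha> \<longrightarrow> \<alpha> = 1)"
    consider "p < \<alpha>" | "p = 1" "\<alpha> = 1" using p by force
    note cases = this
    show "integrable M (\<lambda>\<omega>. S t \<omega> powr p)" if "0 \<le> t" for t
      using cases moment[of p] mean[OF _ that] p that by cases (auto simp: has_bochner_integral_iff)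
    show "(\<lambda>t. expectation (\<lambda>\<omega>. S t \<omega> powr p)) \<sim>[at_top]
        (\<lambda>t. (if p < \<alpha> then Gamma (1 - p / \<alpha>) / Gamma (1 - p) else 1) * t powr (p / \<alpha>))"
      using cases moment[of p] mean_asymp p by cases auto
  qed (use tail in auto)
qed

end
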